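(* Let $R$ be a proper $*$-ring, let $a,y\in R$ and let $k$ be a positive integer. The following assertions are equivalent: (i) $y=a^{\boxplus}$ (i.e. $a$ is weak core invertible with weak core inverse $y$) and $\mathrm{ind}_{wc}(a)\le k$; (ii) $y=yay$, $yR=a^kR=a^{k+1}R$ and $a^kR\subseteq y^*R$; (iii) $y=yay$, $yR=a^kR\subseteq a^{k+1}R$ and ${}^{\circ}(y^* )\subseteq {}^{\circ}(a^k)$; (iv) $y=yay$, ${}^{\circ}(a^{k+1})\subseteq {}^{\circ}(a^k)={}^{\circ}y$ and ${}^{\circ}(y^* )\subseteq {}^{\circ}(a^k)$.
   Context: A proper $*$-ring is a (not necessarily commutative) ring $R$ with unit $1\ne 0$ and an involution $r\mapsto r^*$ satisfying $(r^* )^*=r$, $(r+s)^*=r^*+s^*$, $(rs)^*=s^*r^*$, such that $r^*r=0$ implies $r=0$. Notation: $aR=\{az: z\in R\}$; the left annihilator of $a$ is ${}^{\circ}a=\{z\in R: za=0\}$. An element $y\in R$ is a weak core inverse of $a\in R$ if for some positive integer $k$ one has $ya^{k+1}=a^k$, $ay^2=y$ and $(a^k)^*ay=(a^k)^*$. In a proper $*$-ring it is unique if it exists and is denoted $a^{\boxplus}$; $a$ is then called weak core invertible. The smallest positive integer $k$ for which these three equations hold is the weak core index $\mathrm{ind}_{wc}(a)$. *)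

theory Defs
  imports Main
begin

class star_ring = ring_1 +
  fixes star :: "'a \<Rightarrow> 'a"
  assumes star_star: "star (star r) = r"
    and star_add: "star (r + s) = star r + star s"
    and star_mult: "star (r * s) = star s * star r"

class proper_star_ring = star_ring +
  assumes proper: "star r * r = 0 \<Longrightarrow> r = 0"

definition right_multiples :: "'a::ring_1 \<Rightarrow> 'a set" where
  "right_multiples a = {a * z | z. True}"

definition left_annihilator :: "'a::ring_1 \<Rightarrow> 'a set" where
  "left_annihilator a = {z. z * a = 0}"

definition weak_core_equations :: "nat \<Rightarrow> 'a::star_ring \<Rightarrow> 'a \<Rightarrow> bool" where
  "weak_core_equations k a y \<longleftrightarrow>
     y * a ^ (k + 1) = a ^ k \<and> a * y ^ 2 = y \<and> star (a ^ k) * a * y = star (a ^ k)"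

definition is_weak_core_inverse :: "'a::star_ring \<Rightarrow> 'a \<Rightarrow> bool" where
  "is_weak_core_inverse a y \<longleftrightarrow> (\<exists>k>0. weak_core_equations k a y)"

definition weak_core_invertible :: "'a::star_ring \<Rightarrow> bool" where
  "weak_core_invertible a \<longleftrightarrow> (\<exists>y. is_weak_core_inverse a y)"

text \<open>The next two operations are meaningful only when \<open>a\<close> is weak core invertible;
  the weak core inverse is then unique in a proper star-ring.\<close>

definition weak_core_inverse :: "'a::proper_star_ring \<Rightarrow> 'a" where
  "weak_core_inverse a = (THE y. is_weak_core_inverse a y)"

definition weak_core_index :: "'a::proper_star_ring \<Rightarrow> nat" where
  "weak_core_index a = (LEAST k. k > 0 \<and> weak_core_equations k a (weak_core_inverse a))"

end

theory Submission imports Defs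
begin

text \<open>
  The three defining equations, with a fixed exponent \<open>k\<close>, are the pivot: assertion (i) is
  equivalent to \<open>weak_core_equations k a y\<close>. Indeed these equations persist when \<open>k\<close> grows, so
  that the weak core index is at most \<open>k\<close> exactly when they hold at \<open>k\<close>. Uniqueness of the inverse
  is geometric: \<open>a * y\<close> is the self-adjoint idempotent with range \<open>a^k R\<close>, which determines
  \<open>a * y\<close>, and \<open>y\<close> is recovered from it because \<open>y * a\<close> fixes the elements of \<open>a^k R\<close>.

  The equations give (ii) through the explicit factorizations \<open>y = a^n * y^(n+1)\<close>,
  \<open>a^k = y * a^(k+1)\<close> and \<open>a^k = star y * star a * a^k\<close>. An inclusion of principal right ideals
  reverses to one of left annihilators, hence (ii) implies (iii) and (iii) implies (iv). Finally,
  (iv) returns the equations: up to adjoints, each says that some element of the form \<open>1 - e\<close> kills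
  \<open>a^k\<close> or \<open>y\<close> on the left, and the annihilator conditions transport such statements.
\<close>

lemma right_multiples_subset_iff:
  "right_multiples a \<subseteq> right_multiples b \<longleftrightarrow> (\<exists>z. a = b * z)"
proof
  assume sub: "right_multiples a \<subseteq> right_multiples b"
  have "a * 1 \<in> right_multiples a" unfolding right_multiples_def by blast
  with sub show "\<exists>z. a = b * z" unfolding right_multiples_def by auto
next
  assume "\<exists>z. a = b * z"
  then obtain z where "a = b * z" by blast
  then show "right_multiples a \<subseteq> right_multiples b"
    unfolding right_multiples_def by (auto simp: mult.assoc)
qed

lemma left_annihilator_antimono:
  assumes "right_multiples a \<subseteq> right_multiples b"
  shows "left_annihilator b \<subseteq> left_annihilator a"
proof -
  obtain z where a: "a = b * z"
    using assms by (auto simp: right_multiples_subset_iff)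
  show ?thesis
    unfolding left_annihilator_def a by (auto simp: mult.assoc[symmetric])
qed

text \<open>
  The form in which annihilator inclusions are used: a left multiplication by \<open>e\<close> that fixes \<open>b\<close>
  also fixes \<open>c\<close>, because \<open>1 - e\<close> annihilates \<open>b\<close>.
\<close>

lemma left_fixed_transfer:
  assumes "left_annihilator b \<subseteq> left_annihilator c" and "e * b = b"
  shows "e * c = c"
proof -
  have "1 - e \<in> left_annihilator b"
    using assms(2) by (simp add: left_annihilator_def left_diff_distrib)
  with assms(1) have "(1 - e) * c = 0"
    by (auto simp: left_annihilator_def)
  then show ?thesis by (simp add: left_diff_distrib)
qed

lemma power_mult_power_Suc_eq:
  fixes a y :: "'a::monoid_mult"
  assumes "a * y\<^sup>2 = y"
  shows "a ^ n * y ^ (n + 1) = y"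
proof (induction n)
  case (Suc n)
  have "y ^ (Suc n + 1) = y\<^sup>2 * y ^ n"
    by (simp only: power_add[symmetric]) simp
  then have "a ^ Suc n * y ^ (Suc n + 1) = a ^ n * (a * y\<^sup>2) * y ^ n"
    by (simp only: power_Suc2 mult.assoc)
  also have "\<dots> = a ^ n * y ^ (n + 1)"
    using assms by (simp add: mult.assoc)
  finally show ?case using Suc.IH by simp
qed simp

lemma weak_core_equations_mono:
  assumes eqs: "weak_core_equations k a y" and "k \<le> l"
  shows "weak_core_equations l a y"
proof -
  obtain d where l: "l = k + d" using \<open>k \<le> l\<close> le_Suc_ex by blast
  have eq1: "y * a ^ (k + 1) = a ^ k" and eq2: "a * y ^ 2 = y"
    and eq3: "star (a ^ k) * a * y = star (a ^ k)"
    using eqs by (auto simp: weak_core_equations_def)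
  have "y * a ^ (l + 1) = y * a ^ (k + 1) * a ^ d"
    unfolding l mult.assoc power_add[symmetric] by (simp add: add.commute add.left_commute)
  also have "\<dots> = a ^ l" unfolding eq1 unfolding l power_add ..
  finally have 1: "y * a ^ (l + 1) = a ^ l" .
  have star_l: "star (a ^ l) = star (a ^ d) * star (a ^ k)"
    unfolding l power_add star_mult ..
  have "star (a ^ l) * a * y = star (a ^ d) * (star (a ^ k) * a * y)"
    unfolding star_l by (simp only: mult.assoc)
  then have "star (a ^ l) * a * y = star (a ^ l)" unfolding eq3 star_l .
  with 1 eq2 show ?thesis by (simp add: weak_core_equations_def)
qed

lemma weak_core_equations_outer_inverse:
  assumes "weak_core_equations k a y"
  shows "y * a * y = y"
proof -
  have eq1: "y * a ^ (k + 1) = a ^ k" and y: "a ^ k * y ^ (k + 1) = y"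
    using assms power_mult_power_Suc_eq unfolding weak_core_equations_def by blast+
  have "y * a * y = y * a * (a ^ k * y ^ (k + 1))" unfolding y ..
  also have "\<dots> = y * a ^ (k + 1) * y ^ (k + 1)" by (simp add: mult.assoc)
  also have "\<dots> = y" unfolding eq1 y ..
  finally show ?thesis .
qed

text \<open>
  Since \<open>a * y = a^k * w\<close> for some \<open>w\<close>, multiplying the third equation by \<open>star w\<close> turns it into
  \<open>star (a * y) * (a * y) = star (a * y)\<close>, whose left side is self-adjoint.
\<close>

lemma weak_core_equations_self_adjoint:
  assumes "weak_core_equations k a y"
  shows "star (a * y) = a * y"
proof -
  have eq3: "star (a ^ k) * a * y = star (a ^ k)" and y: "a ^ k * y ^ (k + 1) = y"
    using assms power_mult_power_Suc_eq unfolding weak_core_equations_def by blast+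
  define w where "w = a * y ^ (k + 1)"
  have ay: "a * y = a ^ k * w"
    using arg_cong[OF y, of "(*) a"]
    by (simp add: w_def power_commutes flip: mult.assoc)
  have star_ay: "star (a * y) = star w * star (a ^ k)"
    unfolding ay star_mult ..
  have "star (a * y) * (a * y) = star w * (star (a ^ k) * a * y)"
    unfolding star_ay by (simp only: mult.assoc)
  also have "\<dots> = star (a * y)" unfolding eq3 star_ay ..
  finally have herm: "star (a * y) * (a * y) = star (a * y)" .
  have "a * y = star (star (a * y) * (a * y))" unfolding herm star_star ..
  also have "\<dots> = star (a * y) * (a * y)" unfolding star_mult star_star ..
  finally show ?thesis using herm by simp
qed

lemma weak_core_equations_fix_power:
  assumes "weak_core_equations k a y"
  shows "a * y * a ^ k = a ^ k"
proof -
  have "star (a ^ k) * (a * y) = star (a ^ k)"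
    using assms by (simp add: weak_core_equations_def mult.assoc)
  then have "star (star (a ^ k) * (a * y)) = star (star (a ^ k))" by simp
  then show ?thesis
    using weak_core_equations_self_adjoint[OF assms] by (simp add: star_mult star_star)
qed

text \<open>
  Two self-adjoint idempotents with the same range coincide; here they are \<open>a * x\<close> and \<open>a * y\<close>,
  with range \<open>a^k R\<close>.
\<close>

lemma weak_core_equations_unique:
  assumes x: "weak_core_equations k a x" and y: "weak_core_equations k a y"
  shows "x = y"
proof -
  have absorb: "a * u * (a * v) = a * v"
    if u: "weak_core_equations k a u" and v: "weak_core_equations k a v" for u v
  proof -
    have v_eq: "a ^ k * v ^ (k + 1) = v"
      using v power_mult_power_Suc_eq unfolding weak_core_equations_def by blast
    have av: "a * v = a ^ k * (a * v ^ (k + 1))"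
      using arg_cong[OF v_eq, of "(*) a"] by (simp add: power_commutes flip: mult.assoc)
    have "a * u * (a * v) = a * u * a ^ k * (a * v ^ (k + 1))"
      by (subst av) (simp only: mult.assoc)
    then show ?thesis unfolding weak_core_equations_fix_power[OF u] av[symmetric] .
  qed
  have "a * x = star (a * y * (a * x))"
    using absorb[OF y x] weak_core_equations_self_adjoint[OF x] by simp
  also have "\<dots> = a * x * (a * y)"
    unfolding star_mult[of "a * y"] weak_core_equations_self_adjoint[OF x]
      weak_core_equations_self_adjoint[OF y] ..
  also have "\<dots> = a * y" by (rule absorb[OF x y])
  finally have ax: "a * x = a * y" .
  have eq1: "x * a ^ (k + 1) = a ^ k" and y_eq: "a ^ k * y ^ (k + 1) = y"
    using x y power_mult_power_Suc_eq unfolding weak_core_equations_def by blast+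
  have "x = x * (a * x)"
    using weak_core_equations_outer_inverse[OF x] by (simp add: mult.assoc)
  also have "\<dots> = x * (a * (a ^ k * y ^ (k + 1)))" unfolding ax y_eq ..
  also have "\<dots> = x * a ^ (k + 1) * y ^ (k + 1)" by (simp add: mult.assoc)
  also have "\<dots> = y" unfolding eq1 y_eq ..
  finally show ?thesis .
qed

lemma is_weak_core_inverse_unique:
  assumes "is_weak_core_inverse a x" and "is_weak_core_inverse a y"
  shows "x = y"
proof -
  obtain k l where "weak_core_equations k a x" "weak_core_equations l a y"
    using assms unfolding is_weak_core_inverse_def by blast
  \<comment> \<open>The two exponents may differ, so both triples are moved to the larger one.\<close>
  then have "weak_core_equations (max k l) a x" "weak_core_equations (max k l) a y"
    by (auto intro: weak_core_equations_mono)
  then show ?thesis by (rule weak_core_equations_unique)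
qed

lemma weak_core_inverse_eqI:
  assumes "is_weak_core_inverse a y"
  shows "weak_core_inverse a = y"
  unfolding weak_core_inverse_def
  using assms by (blast intro: is_weak_core_inverse_unique)

lemma weak_core_index_le_iff:
  assumes "k > 0"
  shows "weak_core_invertible a \<and> y = weak_core_inverse a \<and> weak_core_index a \<le> k
    \<longleftrightarrow> weak_core_equations k a y"
proof
  assume L: "weak_core_invertible a \<and> y = weak_core_inverse a \<and> weak_core_index a \<le> k"
  then have "is_weak_core_inverse a y"
    using weak_core_inverse_eqI unfolding weak_core_invertible_def by blast
  then have "\<exists>l. l > 0 \<and> weak_core_equations l a (weak_core_inverse a)"
    using L unfolding is_weak_core_inverse_def by blast
  then have "weak_core_equations (weak_core_index a) a (weak_core_inverse a)"
    unfolding weak_core_index_def by (rule LeastI2_ex) simp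
  with L show "weak_core_equations k a y" by (blast intro: weak_core_equations_mono)
next
  assume eqs: "weak_core_equations k a y"
  with assms have inv: "is_weak_core_inverse a y"
    unfolding is_weak_core_inverse_def by blast
  then have y: "weak_core_inverse a = y" by (rule weak_core_inverse_eqI)
  have "weak_core_index a \<le> k"
    unfolding weak_core_index_def y using assms eqs by (simp add: Least_le)
  with inv y show "weak_core_invertible a \<and> y = weak_core_inverse a \<and> weak_core_index a \<le> k"
    unfolding weak_core_invertible_def by blast
qed

lemma weak_core_equations_right_multiples:
  assumes eqs: "weak_core_equations k a y"
  shows "right_multiples y = right_multiples (a ^ k)"
    and "right_multiples (a ^ k) = right_multiples (a ^ (k + 1))"
    and "right_multiples (a ^ k) \<subseteq> right_multiples (star y)"
proof -
  have eq1: "y * a ^ (k + 1) = a ^ k" and y: "\<And>n. a ^ n * y ^ (n + 1) = y"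
    using eqs power_mult_power_Suc_eq unfolding weak_core_equations_def by blast+
  have y_sub: "right_multiples y \<subseteq> right_multiples (a ^ n)" for n
    unfolding right_multiples_subset_iff using y[of n] by metis
  have sub_y: "right_multiples (a ^ k) \<subseteq> right_multiples y"
    unfolding right_multiples_subset_iff using eq1 by metis
  show "right_multiples y = right_multiples (a ^ k)"
    using y_sub sub_y by blast
  have "a ^ (k + 1) = a ^ k * a" by (simp add: power_commutes)
  then have "right_multiples (a ^ (k + 1)) \<subseteq> right_multiples (a ^ k)"
    unfolding right_multiples_subset_iff by blast
  then show "right_multiples (a ^ k) = right_multiples (a ^ (k + 1))"
    using sub_y y_sub[of "k + 1"] by blast
  have "a ^ k = star (a * y) * a ^ k"
    unfolding weak_core_equations_self_adjoint[OF eqs] weak_core_equations_fix_power[OF eqs] ..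
  then have "a ^ k = star y * (star a * a ^ k)"
    by (simp add: star_mult mult.assoc)
  then show "right_multiples (a ^ k) \<subseteq> right_multiples (star y)"
    unfolding right_multiples_subset_iff by blast
qed

text \<open>
  The identities \<open>y * a * y = y\<close> and \<open>star y * star a * star y = star y\<close> exhibit left multiplications
  fixing \<open>y\<close> and \<open>star y\<close>; transported to \<open>a^k\<close> they are the first equation and the adjoint of the
  third. For the second equation, \<open>a * y\<close> fixes \<open>a^(k+1)\<close> by the first one, hence \<open>a^k\<close>, hence \<open>y\<close>.
\<close>

lemma weak_core_equationsI_left_annihilator:
  assumes yay: "y * a * y = y"
    and index: "left_annihilator (a ^ (k + 1)) \<subseteq> left_annihilator (a ^ k)"
    and ann: "left_annihilator (a ^ k) = left_annihilator y"
    and ann_star: "left_annihilator (star y) \<subseteq> left_annihilator (a ^ k)"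
  shows "weak_core_equations k a y"
proof -
  have "y * a * a ^ k = a ^ k"
    using left_fixed_transfer[of y "a ^ k", OF _ yay] ann by simp
  then have eq1: "y * a ^ (k + 1) = a ^ k" by (simp add: mult.assoc)
  have "a * y * a ^ (k + 1) = a ^ (k + 1)"
    using eq1 by (simp add: mult.assoc)
  then have "a * y * a ^ k = a ^ k" by (rule left_fixed_transfer[OF index])
  then have "a * y * y = y" using left_fixed_transfer[of "a ^ k" y] ann by blast
  then have eq2: "a * y ^ 2 = y" by (simp add: power2_eq_square mult.assoc)
  have "star (a * y) * star y = star y"
    using arg_cong[OF yay, of star] by (simp add: star_mult mult.assoc)
  then have "star (a * y) * a ^ k = a ^ k" by (rule left_fixed_transfer[OF ann_star])
  then have "star (star (a * y) * a ^ k) = star (a ^ k)" by simp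
  then have "star (a ^ k) * a * y = star (a ^ k)"
    unfolding star_mult[of "star (a * y)"] star_star by (simp add: mult.assoc)
  with eq1 eq2 show ?thesis by (simp add: weak_core_equations_def)
qed

theorem theorem3p4:
  fixes a y :: "'a::proper_star_ring" and k :: nat
  assumes "k > 0"
  defines "i \<equiv> weak_core_invertible a \<and> y = weak_core_inverse a \<and> weak_core_index a \<le> k"
    and "ii \<equiv> y = y * a * y \<and> right_multiples y = right_multiples (a ^ k)
          \<and> right_multiples (a ^ k) = right_multiples (a ^ (k + 1))
          \<and> right_multiples (a ^ k) \<subseteq> right_multiples (star y)"
    and "iii \<equiv> y = y * a * y \<and> right_multiples y = right_multiples (a ^ k)
          \<and> right_multiples (a ^ k) \<subseteq> right_multiples (a ^ (k + 1))
          \<and> left_annihilator (star y) \<subseteq> left_annihilator (a ^ k)"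
    and "iv \<equiv> y = y * a * y \<and> left_annihilator (a ^ (k + 1)) \<subseteq> left_annihilator (a ^ k)
          \<and> left_annihilator (a ^ k) = left_annihilator y
          \<and> left_annihilator (star y) \<subseteq> left_annihilator (a ^ k)"
  shows "(i \<longleftrightarrow> ii) \<and> (i \<longleftrightarrow> iii) \<and> (i \<longleftrightarrow> iv)"
proof -
  have i_iff: "i \<longleftrightarrow> weak_core_equations k a y"
    unfolding i_def by (rule weak_core_index_le_iff[OF \<open>k > 0\<close>])
  have "ii" if "i"
  proof -
    have eqs: "weak_core_equations k a y" using that i_iff by blast
    show ?thesis
      unfolding ii_def
      using weak_core_equations_outer_inverse[OF eqs] weak_core_equations_right_multiples[OF eqs]
      by auto
  qed
  moreover have "iii" if "ii"
    using that left_annihilator_antimono unfolding ii_def iii_def by blast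
  moreover have "iv" if "iii"
    using that left_annihilator_antimono[of y "a ^ k"] left_annihilator_antimono[of "a ^ k" y]
      left_annihilator_antimono[of "a ^ k" "a ^ (k + 1)"]
    unfolding iii_def iv_def by blast
  moreover have "i" if "iv"
    unfolding i_iff
    using that unfolding iv_def by (intro weak_core_equationsI_left_annihilator) auto
  ultimately show ?thesis by blast
qed

end
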